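(* There exists a closed complex submanifold $Y\subset\mathbb{C}^5$ of complex dimension three which is a differentiable complete intersection in $\mathbb{C}^5$ but is not a holomorphic complete intersection in $\mathbb{C}^5$.
   Context: A closed complex submanifold $Y$ of complex codimension $d$ in a complex manifold $X$ is a holomorphic complete intersection in $X$ if there exist $d$ holomorphic functions $f_1,\ldots,f_d\in\mathcal{O}(X)$ such that $Y=\{x\in X: f_1(x)=\cdots=f_d(x)=0\}$ and the differentials $df_1(x),\ldots,df_d(x)$ are $\mathbb{C}$-linearly independent at each point $x\in Y$. A smooth real submanifold $Y$ of real codimension $k$ in a smooth manifold $X$ is a differentiable complete intersection in $X$ if there exist $k$ smooth real-valued functions $f_1,\ldots,f_k$ on $X$ such that $Y=\{x\in X: f_1(x)=\cdots=f_k(x)=0\}$ and the differentials $df_1(x),\ldots,df_k(x)$ are $\mathbb{R}$-linearly independent at each point $x\in Y$. A complex submanifold of complex codimension $d$ is regarded here as a smooth real submanifold of real codimension $2d$. *)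

theory Defs
  imports "HOL-Analysis.Analysis"
begin

text \<open>
  Complex Euclidean space is \<open>complex^'n\<close>. Its library derivative is the real Frechet
  derivative, and \<open>*s\<close> is multiplication by complex scalars.
\<close>

definition holomorphic_fun_on :: "(complex^'n \<Rightarrow> complex) \<Rightarrow> (complex^'n) set \<Rightarrow> bool" where
  "holomorphic_fun_on f U \<longleftrightarrow>
     (\<forall>x\<in>U. \<exists>f'. (f has_derivative f') (at x) \<and> (\<forall>c v. f' (c *s v) = c * f' v))"

definition holomorphic_map_on :: "(complex^'n \<Rightarrow> complex^'m) \<Rightarrow> (complex^'n) set \<Rightarrow> bool" where
  "holomorphic_map_on F U \<longleftrightarrow> (\<forall>i. holomorphic_fun_on (\<lambda>x. F x $ i) U)"

definition biholomorphism ::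
  "(complex^'n) set \<Rightarrow> (complex^'n) set \<Rightarrow> (complex^'n \<Rightarrow> complex^'n) \<Rightarrow> (complex^'n \<Rightarrow> complex^'n) \<Rightarrow> bool"
  where
  "biholomorphism U V \<phi> \<psi> \<longleftrightarrow>
     open U \<and> open V \<and> homeomorphism U V \<phi> \<psi> \<and> holomorphic_map_on \<phi> U \<and> holomorphic_map_on \<psi> V"

text \<open>
  Closed submanifolds of pure complex dimension \<open>m\<close>, by flattening charts of the ambient
  space; connectedness is not required. The set \<open>I\<close> selects the coordinates that span the model
  subspace, so that no ordering of the index type is needed.
\<close>

definition closed_complex_submanifold :: "nat \<Rightarrow> (complex^'n) set \<Rightarrow> bool" where
  "closed_complex_submanifold m Y \<longleftrightarrow>
     closed Y \<and>
     (\<forall>p\<in>Y. \<exists>U V \<phi> \<psi> I.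
        p \<in> U \<and> biholomorphism U V \<phi> \<psi> \<and> card I = m \<and>
        \<phi> ` (Y \<inter> U) = {z \<in> V. \<forall>i. i \<notin> I \<longrightarrow> z $ i = 0})"

text \<open>
  Linear independence of the differentials is that of the family indexed by \<open>i < d\<close> (not of the
  set of its values), so repetitions count as dependence. In both definitions below, \<open>Y\<close> is meant
  to be a submanifold of codimension \<open>d\<close> (complex) or \<open>k\<close> (real), respectively.
\<close>

definition holomorphic_complete_intersection :: "nat \<Rightarrow> (complex^'n) set \<Rightarrow> bool" where
  "holomorphic_complete_intersection d Y \<longleftrightarrow>
     (\<exists>f :: nat \<Rightarrow> complex^'n \<Rightarrow> complex.
        (\<forall>i<d. holomorphic_fun_on (f i) UNIV) \<and>
        Y = {x. \<forall>i<d. f i x = 0} \<and>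
        (\<forall>x\<in>Y. \<forall>c :: nat \<Rightarrow> complex.
           (\<forall>v. (\<Sum>i<d. c i * frechet_derivative (f i) (at x) v) = 0) \<longrightarrow> (\<forall>i<d. c i = 0)))"

text \<open>
  \<open>Ck_fun k f\<close>: \<open>f\<close> is \<open>k\<close> times continuously differentiable on the whole space. In finite
  dimension, the derivative is of class \<open>C\<^sup>k\<close> iff all directional derivatives are.
\<close>

primrec Ck_fun :: "nat \<Rightarrow> ('a::euclidean_space \<Rightarrow> real) \<Rightarrow> bool" where
  "Ck_fun 0 f \<longleftrightarrow> continuous_on UNIV f"
| "Ck_fun (Suc k) f \<longleftrightarrow>
     (\<forall>x. f differentiable (at x)) \<and> (\<forall>v. Ck_fun k (\<lambda>x. frechet_derivative f (at x) v))"

definition smooth_fun :: "('a::euclidean_space \<Rightarrow> real) \<Rightarrow> bool" where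
  "smooth_fun f \<longleftrightarrow> (\<forall>k. Ck_fun k f)"

definition differentiable_complete_intersection :: "nat \<Rightarrow> 'a::euclidean_space set \<Rightarrow> bool" where
  "differentiable_complete_intersection k Y \<longleftrightarrow>
     (\<exists>f :: nat \<Rightarrow> 'a \<Rightarrow> real.
        (\<forall>i<k. smooth_fun (f i)) \<and>
        Y = {x. \<forall>i<k. f i x = 0} \<and>
        (\<forall>x\<in>Y. \<forall>c :: nat \<Rightarrow> real.
           (\<forall>v. (\<Sum>i<k. c i * frechet_derivative (f i) (at x) v) = 0) \<longrightarrow> (\<forall>i<k. c i = 0)))"

end

theory Submission
  imports Defs "HOL-Complex_Analysis.Cauchy_Integral_Formula"
begin

text \<open>
  Let \<open>Q\<close> be the affine quadric of idempotent \<open>2 \<times> 2\<close> matrices of rank one; it is homotopy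
  equivalent to its real form, the two-sphere of orthogonal projections \<open>v v\<^sup>*\<close>. The threefold is the
  total space of the line bundle over \<open>Q\<close> whose fibre over the matrix with image \<open>\<complex> v\<close> is the line
  spanned by \<open>(v\<^sub>0\<^sup>2, v\<^sub>1\<^sup>2)\<close>. Its normal bundle has first Chern class of absolute value 2 on the sphere.
  This class is nonzero, so the normal bundle is not trivial as a complex bundle: a pair of
  holomorphic defining functions would yield a nowhere vanishing function on the three-sphere
  that has weight \<open>-2\<close> under the circle action.

  The class is even, so the normal bundle is trivial as a real bundle: the quotient of \<open>\<complex>\<^sup>2\<close> by
  the line is isomorphic to the tangent bundle of the sphere, and adding a normal direction
  makes it \<open>\<real>\<^sup>3\<close>. With \<open>Q = {q \<in> \<complex>\<^sup>3. q \<bullet> q = 1}\<close> and \<open>x = Re q\<close>, the global defining functions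
  are \<open>Re (q \<bullet> q - 1)\<close> and the components of \<open>Im (q \<bullet> q) x + x \<times> Re T\<close> up to constants, where \<open>T\<close>
  is a polynomial, isotropic vector orthogonal to \<open>q\<close> that vanishes on \<open>Q\<close> exactly along the
  threefold. The first function keeps \<open>x\<close> away from 0 on its zero set.
\<close>

subsection \<open>Holomorphic functions and charts\<close>

lemma exhaust_5: "x = 1 \<or> x = 2 \<or> x = 3 \<or> x = 4 \<or> x = 5" for x :: 5
proof (induct x)
  case (of_int z)
  then have "z = 0 \<or> z = 1 \<or> z = 2 \<or> z = 3 \<or> z = 4" by fastforce
  then show ?case by auto
qed

lemma forall_5: "(\<forall>i::5. P i) \<longleftrightarrow> P 1 \<and> P 2 \<and> P 3 \<and> P 4 \<and> P 5"
  by (metis exhaust_5)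

lemma vector_5 [simp]:
  "(vector [a, b, c, d, e] :: 'a::zero^5) $ 1 = a"
  "(vector [a, b, c, d, e] :: 'a::zero^5) $ 2 = b"
  "(vector [a, b, c, d, e] :: 'a::zero^5) $ 3 = c"
  "(vector [a, b, c, d, e] :: 'a::zero^5) $ 4 = d"
  "(vector [a, b, c, d, e] :: 'a::zero^5) $ 5 = e"
  unfolding vector_def by auto

lemma holomorphic_fun_on_const: "holomorphic_fun_on (\<lambda>x. c) U"
  unfolding holomorphic_fun_on_def by (intro ballI exI[of _ "\<lambda>v. 0"]) auto

lemma holomorphic_fun_on_nth: "holomorphic_fun_on (\<lambda>x. x $ i) U"
  unfolding holomorphic_fun_on_def
  by (intro ballI exI[of _ "\<lambda>v. v $ i"])
     (auto intro!: bounded_linear_imp_has_derivative bounded_linear_vec_nth)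

lemma holomorphic_fun_on_add:
  assumes "holomorphic_fun_on f U" "holomorphic_fun_on g U"
  shows "holomorphic_fun_on (\<lambda>x. f x + g x) U"
  unfolding holomorphic_fun_on_def
proof
  fix x assume "x \<in> U"
  then obtain f' g' where "(f has_derivative f') (at x)" "\<forall>c v. f' (c *s v) = c * f' v"
    "(g has_derivative g') (at x)" "\<forall>c v. g' (c *s v) = c * g' v"
    using assms unfolding holomorphic_fun_on_def by blast
  then show "\<exists>h. ((\<lambda>x. f x + g x) has_derivative h) (at x) \<and> (\<forall>c v. h (c *s v) = c * h v)"
    by (intro exI[of _ "\<lambda>v. f' v + g' v"]) (auto intro: has_derivative_add simp: algebra_simps)
qed

lemma holomorphic_fun_on_mult:
  assumes "holomorphic_fun_on f U" "holomorphic_fun_on g U"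
  shows "holomorphic_fun_on (\<lambda>x. f x * g x) U"
  unfolding holomorphic_fun_on_def
proof
  fix x assume "x \<in> U"
  then obtain f' g' where "(f has_derivative f') (at x)" "\<forall>c v. f' (c *s v) = c * f' v"
    "(g has_derivative g') (at x)" "\<forall>c v. g' (c *s v) = c * g' v"
    using assms unfolding holomorphic_fun_on_def by blast
  then show "\<exists>h. ((\<lambda>x. f x * g x) has_derivative h) (at x) \<and> (\<forall>c v. h (c *s v) = c * h v)"
    by (intro exI[of _ "\<lambda>v. f x * g' v + f' v * g x"])
       (auto intro: has_derivative_mult simp: algebra_simps)
qed

lemma holomorphic_fun_on_compose_field:
  assumes f: "holomorphic_fun_on f U"
    and g: "\<And>x. x \<in> U \<Longrightarrow> g field_differentiable at (f x)"
  shows "holomorphic_fun_on (\<lambda>x. g (f x)) U"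
  unfolding holomorphic_fun_on_def
proof
  fix x assume x: "x \<in> U"
  then obtain f' where f': "(f has_derivative f') (at x)" "\<forall>c v. f' (c *s v) = c * f' v"
    using f unfolding holomorphic_fun_on_def by blast
  obtain d where "(g has_field_derivative d) (at (f x))"
    using g[OF x] unfolding field_differentiable_def by blast
  then have "(g has_derivative (*) d) (at (f x))"
    by (simp add: has_field_derivative_def)
  from has_derivative_compose[OF f'(1) this] f'(2)
  show "\<exists>h. ((\<lambda>x. g (f x)) has_derivative h) (at x) \<and> (\<forall>c v. h (c *s v) = c * h v)"
    by (intro exI[of _ "\<lambda>v. d * f' v"]) auto
qed

lemma holomorphic_fun_on_diff:
  assumes "holomorphic_fun_on f U" "holomorphic_fun_on g U"
  shows "holomorphic_fun_on (\<lambda>x. f x - g x) U"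
  using holomorphic_fun_on_add[OF assms(1) holomorphic_fun_on_mult[OF holomorphic_fun_on_const assms(2)],
      of "-1"] by simp

lemma holomorphic_fun_on_power:
  "holomorphic_fun_on f U \<Longrightarrow> holomorphic_fun_on (\<lambda>x. f x ^ n) U"
  by (induction n) (auto intro: holomorphic_fun_on_const holomorphic_fun_on_mult)

lemma holomorphic_fun_on_divide:
  assumes "holomorphic_fun_on f U" "holomorphic_fun_on g U" "\<And>x. x \<in> U \<Longrightarrow> g x \<noteq> 0"
  shows "holomorphic_fun_on (\<lambda>x. f x / g x) U"
proof -
  have "holomorphic_fun_on (\<lambda>x. inverse (g x)) U"
    using assms(3)
    by (intro holomorphic_fun_on_compose_field[OF assms(2)] field_differentiable_inverse
        field_differentiable_ident)
  then show ?thesis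
    using holomorphic_fun_on_mult[OF assms(1)] by (simp add: divide_inverse)
qed

lemma holomorphic_fun_on_csqrt:
  assumes "holomorphic_fun_on f U" "\<And>x. x \<in> U \<Longrightarrow> f x \<notin> \<real>\<^sub>\<le>\<^sub>0"
  shows "holomorphic_fun_on (\<lambda>x. csqrt (f x)) U"
  using assms(2)
  by (intro holomorphic_fun_on_compose_field[OF assms(1)] field_differentiable_at_csqrt)

lemmas holomorphic_fun_on_intros =
  holomorphic_fun_on_const holomorphic_fun_on_nth holomorphic_fun_on_add holomorphic_fun_on_diff
  holomorphic_fun_on_mult holomorphic_fun_on_power holomorphic_fun_on_divide holomorphic_fun_on_csqrt

lemma holomorphic_fun_on_imp_continuous_on:
  assumes "holomorphic_fun_on f U"
  shows "continuous_on U f"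
  using assms unfolding holomorphic_fun_on_def
  by (meson continuous_at_imp_continuous_on has_derivative_continuous)

lemma holomorphic_map_on_imp_continuous_on:
  assumes "holomorphic_map_on F U"
  shows "continuous_on U F"
proof -
  have "continuous_on U (\<lambda>x. \<chi> i. F x $ i)"
    using assms unfolding holomorphic_map_on_def
    by (intro continuous_on_vec_lambda holomorphic_fun_on_imp_continuous_on) auto
  then show ?thesis by simp
qed

lemma biholomorphismI:
  assumes "open U" "open V" "holomorphic_map_on \<phi> U" "holomorphic_map_on \<psi> V"
    and "\<And>x. x \<in> U \<Longrightarrow> \<phi> x \<in> V \<and> \<psi> (\<phi> x) = x"
    and "\<And>z. z \<in> V \<Longrightarrow> \<psi> z \<in> U \<and> \<phi> (\<psi> z) = z"
  shows "biholomorphism U V \<phi> \<psi>"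
  unfolding biholomorphism_def
  using assms by (auto intro!: homeomorphismI holomorphic_map_on_imp_continuous_on)

lemma biholomorphism_image_Int:
  assumes "biholomorphism U V \<phi> \<psi>" and "\<And>x. x \<in> U \<Longrightarrow> x \<in> Y \<longleftrightarrow> \<phi> x \<in> S"
  shows "\<phi> ` (Y \<inter> U) = V \<inter> S"
proof -
  have "homeomorphism U V \<phi> \<psi>"
    using assms(1) unfolding biholomorphism_def by blast
  then have "\<phi> ` U = V" unfolding homeomorphism_def by blast
  then show ?thesis using assms(2) by auto
qed

subsection \<open>The threefold\<close>

text \<open>Coordinates on \<open>\<complex>\<^sup>5\<close> are \<open>(a, b, c, w0, w1)\<close>. The quadric consists of the idempotent rank one
  matrices \<open>P = ((a, b), (c, 1 - a)) = v u\<^sup>T\<close> with \<open>u\<^sup>T v = 1\<close>, and \<open>sec00\<close>, \<open>sec01\<close>, \<open>sec11\<close> are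
  then the products \<open>s u\<^sub>0\<^sup>2\<close>, \<open>s u\<^sub>0 u\<^sub>1\<close>, \<open>s u\<^sub>1\<^sup>2\<close> for \<open>s = w0 v\<^sub>1\<^sup>2 - w1 v\<^sub>0\<^sup>2\<close>.\<close>

definition quadric :: "complex^5 \<Rightarrow> complex" where
  "quadric x = x$1 * (1 - x$1) - x$2 * x$3"

definition sec00 :: "complex^5 \<Rightarrow> complex" where
  "sec00 x = x$4 * (x$3)\<^sup>2 - x$5 * (x$1)\<^sup>2"

definition sec01 :: "complex^5 \<Rightarrow> complex" where
  "sec01 x = x$4 * x$3 * (1 - x$1) - x$5 * x$1 * x$2"

definition sec11 :: "complex^5 \<Rightarrow> complex" where
  "sec11 x = x$4 * (1 - x$1)\<^sup>2 - x$5 * (x$2)\<^sup>2"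

lemmas sec_defs = sec00_def sec01_def sec11_def

definition threefold :: "(complex^5) set" where
  "threefold = {x. quadric x = 0 \<and> sec00 x = 0 \<and> sec11 x = 0}"

text \<open>On the quadric the sections are \<open>s u0^2\<close>, \<open>s u0 u1\<close>,
  \<open>s u1^2\<close>, so \<open>sec01^2 - sec00 sec11\<close> vanishes there; off it the defect
  is a multiple of \<open>quadric^2\<close>. Thus the three equations of \<open>threefold\<close>
  force \<open>sec01 = 0\<close>.\<close>

lemma sec01_square: "(sec01 x)\<^sup>2 = sec00 x * sec11 x + x$4 * x$5 * (quadric x)\<^sup>2"
  unfolding sec_defs quadric_def by algebra

lemma threefold_iff:
  "x \<in> threefold \<longleftrightarrow> quadric x = 0 \<and> sec00 x = 0 \<and> sec01 x = 0 \<and> sec11 x = 0"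
  using sec01_square[of x] unfolding threefold_def by auto

lemma closed_threefold: "closed threefold"
  unfolding threefold_def quadric_def sec_defs
  by (intro closed_Collect_conj closed_Collect_eq continuous_intros)

section \<open>Flattening charts of the threefold\<close>

lemma holomorphic_map_on_vector_5:
  assumes "holomorphic_fun_on a U" "holomorphic_fun_on b U" "holomorphic_fun_on c U"
    "holomorphic_fun_on d U" "holomorphic_fun_on e U"
  shows "holomorphic_map_on (\<lambda>x. vector [a x, b x, c x, d x, e x] :: complex^5) U"
  using assms unfolding holomorphic_map_on_def forall_5 by simp

text \<open>Where \<open>c \<noteq> 0\<close>, \<open>quadric = 0\<close> is solved for
  \<open>b\<close> and \<open>sec00 = 0\<close> for \<open>w0\<close>. The threefold is then a graph
  over \<open>(a, c, w1)\<close>, and the shear \<open>\<phi>\<close> subtracts the graph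
  functions.\<close>

lemma threefold_chart_c:
  assumes "p$3 \<noteq> 0"
  shows "\<exists>U V \<phi> \<psi> I. p \<in> U \<and> biholomorphism U V \<phi> \<psi> \<and> card I = 3 \<and>
           \<phi> ` (threefold \<inter> U) = {z \<in> V. \<forall>i. i \<notin> I \<longrightarrow> z $ i = 0}"
proof -
  define U where "U = {x::complex^5. x$3 \<noteq> 0}"
  define \<phi> where "\<phi> x = (vector [x$1, x$2 - x$1*(1-x$1)/x$3, x$3, x$4 - (x$1)\<^sup>2*x$5/(x$3)\<^sup>2, x$5] :: complex^5)"
    for x :: "complex^5"
  define \<psi> where "\<psi> x = (vector [x$1, x$2 + x$1*(1-x$1)/x$3, x$3, x$4 + (x$1)\<^sup>2*x$5/(x$3)\<^sup>2, x$5] :: complex^5)"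
    for x :: "complex^5"
  have bi: "biholomorphism U U \<phi> \<psi>"
  proof (rule biholomorphismI)
    show "open U" unfolding U_def by (intro open_Collect_neq continuous_intros)
    then show "open U" .
    show "holomorphic_map_on \<phi> U" "holomorphic_map_on \<psi> U" unfolding \<phi>_def \<psi>_def
      by (intro holomorphic_map_on_vector_5 holomorphic_fun_on_intros; simp add: U_def)+
  qed (auto simp: U_def \<phi>_def \<psi>_def vec_eq_iff forall_5)
  have iff: "x \<in> threefold \<longleftrightarrow> \<phi> x \<in> {z. \<forall>i. i \<notin> {1,3,5} \<longrightarrow> z $ i = 0}" if "x \<in> U" for x
  proof -
    have c: "x$3 \<noteq> 0" using that by (simp add: U_def)
    have "x \<in> threefold \<longleftrightarrow> x$2 = x$1*(1-x$1)/x$3 \<and> x$4 = (x$1)\<^sup>2*x$5/(x$3)\<^sup>2"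
    proof
      assume "x \<in> threefold"
      then show "x$2 = x$1*(1-x$1)/x$3 \<and> x$4 = (x$1)\<^sup>2*x$5/(x$3)\<^sup>2"
        using c by (auto simp: threefold_def quadric_def sec_defs field_simps)
    next
      assume *: "x$2 = x$1*(1-x$1)/x$3 \<and> x$4 = (x$1)\<^sup>2*x$5/(x$3)\<^sup>2"
      show "x \<in> threefold"
        using c unfolding threefold_def quadric_def sec_defs mem_Collect_eq conjunct1[OF *] conjunct2[OF *]
        by (simp add: power_divide power_mult_distrib)
    qed
    then show ?thesis by (auto simp: forall_5 \<phi>_def)
  qed
  have "card {1,3,5::5} = 3" by simp
  moreover have "p \<in> U" using assms by (simp add: U_def)
  moreover have "\<phi> ` (threefold \<inter> U) = {z \<in> U. \<forall>i. i \<notin> {1,3,5} \<longrightarrow> z $ i = 0}"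
    using biholomorphism_image_Int[OF bi iff] by auto
  ultimately show ?thesis using bi by blast
qed

lemma csqrt_Re_pos: "z \<notin> \<real>\<^sub>\<le>\<^sub>0 \<Longrightarrow> 0 < Re (csqrt z)"
proof (rule ccontr)
  assume z: "z \<notin> \<real>\<^sub>\<le>\<^sub>0" and "\<not> 0 < Re (csqrt z)"
  then have "Re (csqrt z) = 0" using Re_csqrt[of z] by linarith
  moreover have "z = (csqrt z)\<^sup>2" by simp
  ultimately have "Im z = 0" "Re z \<le> 0"
    by (metis Im_power2 mult_zero_right mult_zero_left, metis Re_power2 diff_0 neg_le_0_iff_le power_zero_numeral zero_le_power2)
  then show False using z by (simp add: complex_nonpos_Reals_iff)
qed

lemma power2_notin_nonpos_Reals:
  assumes "0 < Re w"
  shows "w\<^sup>2 \<notin> \<real>\<^sub>\<le>\<^sub>0"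
  using assms by (auto simp: complex_nonpos_Reals_iff Re_power2 Im_power2)

lemma open_slit: "open {x::complex^5. 1 - 4 * (x$1 + x$2 * x$3) \<notin> \<real>\<^sub>\<le>\<^sub>0}"
proof -
  have "open ((\<lambda>x::complex^5. 1 - 4 * (x$1 + x$2 * x$3)) -` (- \<real>\<^sub>\<le>\<^sub>0))"
    by (intro open_vimage open_Compl closed_nonpos_Reals_complex continuous_intros)
  then show ?thesis by (simp add: vimage_def)
qed

text \<open>Near the poles \<open>b = c = 0\<close> of the quadric, \<open>a\<close> is a root of \<open>a (1 - a) - b c = t\<close> and
  hence a holomorphic function of \<open>(t, b, c)\<close>.\<close>

lemma threefold_chart_a:
  assumes "1/2 < Re (p$1)"
  shows "\<exists>U V \<phi> \<psi> I. p \<in> U \<and> biholomorphism U V \<phi> \<psi> \<and> card I = 3 \<and>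
           \<phi> ` (threefold \<inter> U) = {z \<in> V. \<forall>i. i \<notin> I \<longrightarrow> z $ i = 0}"
proof -
  define U where "U = {x::complex^5. 1/2 < Re (x$1)}"
  define V where "V = {x::complex^5. 1 - 4 * (x$1 + x$2 * x$3) \<notin> \<real>\<^sub>\<le>\<^sub>0}"
  \<comment> \<open>Quadratic formula for \<open>r (1 - r) = t + b c\<close>, where \<open>t\<close>
    is the first target coordinate. The branch is the root with real part above 1/2, holomorphic off
    the slit removed in \<open>V\<close>.\<close>
  define r where "r x = (1 + csqrt (1 - 4 * (x$1 + x$2 * x$3))) / 2" for x :: "complex^5"
  define \<phi> where "\<phi> x = (vector [quadric x, x$2, x$3, x$4, x$5 - (x$3)\<^sup>2*x$4/(x$1)\<^sup>2] :: complex^5)"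
    for x :: "complex^5"
  define \<psi> where "\<psi> x = (vector [r x, x$2, x$3, x$4, x$5 + (x$3)\<^sup>2*x$4/(r x)\<^sup>2] :: complex^5)"
    for x :: "complex^5"
  have a0: "x$1 \<noteq> 0" if "x \<in> U" for x using that by (auto simp: U_def)
  have r1: "1/2 < Re (r x)" if "x \<in> V" for x
    using csqrt_Re_pos[of "1 - 4 * (x$1 + x$2 * x$3)"] that by (simp add: V_def r_def)
  then have r0: "r x \<noteq> 0" if "x \<in> V" for x using that by fastforce
  have rq: "r x * (1 - r x) = x$1 + x$2 * x$3" for x
    using power2_csqrt[of "1 - 4 * (x$1 + x$2 * x$3)"] unfolding r_def
    by (simp add: field_simps power2_eq_square)
  have hr: "holomorphic_fun_on r V" unfolding r_def
    by (intro holomorphic_fun_on_intros) (auto simp: V_def)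
  \<comment> \<open>With \<open>t = quadric x\<close> the discriminant is the square of
    \<open>2 a - 1\<close>, which has positive real part on \<open>U\<close>; so
    \<open>csqrt\<close> returns it and \<open>r\<close> recovers \<open>a\<close>.\<close>
  have sq: "1 - 4 * (quadric x + x$2 * x$3) = (2 * x$1 - 1)\<^sup>2" for x
    by (simp add: quadric_def power2_eq_square algebra_simps)
  have bi: "biholomorphism U V \<phi> \<psi>"
  proof (rule biholomorphismI)
    show "open U" unfolding U_def by (intro open_Collect_less continuous_intros)
    show "open V" unfolding V_def by (rule open_slit)
    show "holomorphic_map_on \<phi> U" unfolding \<phi>_def quadric_def
      by (intro holomorphic_map_on_vector_5 holomorphic_fun_on_intros; simp add: a0)
    show "holomorphic_map_on \<psi> V" unfolding \<psi>_def
      by (intro holomorphic_map_on_vector_5 holomorphic_fun_on_intros hr; simp add: r0)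
    show "\<phi> x \<in> V \<and> \<psi> (\<phi> x) = x" if "x \<in> U" for x
    proof -
      have pos: "0 < Re (2 * x$1 - 1)" using that by (simp add: U_def)
      have "csqrt ((2 * x$1 - 1)\<^sup>2) = 2 * x$1 - 1" using pos by (intro csqrt_square) auto
      moreover have "r (\<phi> x) = (1 + csqrt ((2 * x$1 - 1)\<^sup>2)) / 2"
        unfolding r_def \<phi>_def vector_5 sq ..
      ultimately have "r (\<phi> x) = x$1" by simp
      moreover have "\<phi> x \<in> V"
        using power2_notin_nonpos_Reals[OF pos] unfolding V_def \<phi>_def mem_Collect_eq vector_5 sq .
      ultimately show ?thesis by (simp add: \<psi>_def vec_eq_iff forall_5) (simp add: \<phi>_def)
    qed
    show "\<psi> z \<in> U \<and> \<phi> (\<psi> z) = z" if "z \<in> V" for z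
      using r1[OF that] rq[of z] by (simp add: U_def \<phi>_def \<psi>_def vec_eq_iff forall_5 quadric_def)
  qed
  have iff: "x \<in> threefold \<longleftrightarrow> \<phi> x \<in> {z. \<forall>i. i \<notin> {2,3,4} \<longrightarrow> z $ i = 0}" if "x \<in> U" for x
  proof -
    have a: "x$1 \<noteq> 0" using a0[OF that] .
    \<comment> \<open>\<open>a^2 sec11\<close> lies in the ideal of \<open>quadric\<close> and
      \<open>sec00\<close>, and \<open>a\<close> is invertible on \<open>U\<close>.\<close>
    have "sec11 x = 0" if q: "quadric x = 0" and s: "sec00 x = 0"
    proof -
      have "(x$1)\<^sup>2 * sec11 x = x$4 * (x$1*(1 - x$1) + x$2*x$3) * quadric x + (x$2)\<^sup>2 * sec00 x"
        unfolding quadric_def sec_defs by algebra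
      then show ?thesis using a q s by simp
    qed
    then have "x \<in> threefold \<longleftrightarrow> quadric x = 0 \<and> x$5 = (x$3)\<^sup>2*x$4/(x$1)\<^sup>2"
      using a by (auto simp: threefold_def sec00_def field_simps)
    then show ?thesis by (auto simp: forall_5 \<phi>_def)
  qed
  have "card {2,3,4::5} = 3" by simp
  moreover have "p \<in> U" using assms by (simp add: U_def)
  moreover have "\<phi> ` (threefold \<inter> U) = {z \<in> V. \<forall>i. i \<notin> {2,3,4} \<longrightarrow> z $ i = 0}"
    using biholomorphism_image_Int[OF bi iff] by auto
  ultimately show ?thesis using bi by blast
qed

text \<open>Exchanging \<open>a\<close> with \<open>1 - a\<close>, \<open>b\<close> with
  \<open>c\<close> and \<open>w0\<close> with \<open>w1\<close> preserves the threefold and carries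
  this half-space to the one with \<open>Re a > 1/2\<close>; the other root of the quadratic is
  taken.\<close>

lemma threefold_chart_1_minus_a:
  assumes "Re (p$1) < 1/2"
  shows "\<exists>U V \<phi> \<psi> I. p \<in> U \<and> biholomorphism U V \<phi> \<psi> \<and> card I = 3 \<and>
           \<phi> ` (threefold \<inter> U) = {z \<in> V. \<forall>i. i \<notin> I \<longrightarrow> z $ i = 0}"
proof -
  define U where "U = {x::complex^5. Re (x$1) < 1/2}"
  define V where "V = {x::complex^5. 1 - 4 * (x$1 + x$2 * x$3) \<notin> \<real>\<^sub>\<le>\<^sub>0}"
  define r where "r x = (1 - csqrt (1 - 4 * (x$1 + x$2 * x$3))) / 2" for x :: "complex^5"
  define \<phi> where "\<phi> x = (vector [quadric x, x$2, x$3, x$4 - (x$2)\<^sup>2*x$5/(1 - x$1)\<^sup>2, x$5] :: complex^5)"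
    for x :: "complex^5"
  define \<psi> where "\<psi> x = (vector [r x, x$2, x$3, x$4 + (x$2)\<^sup>2*x$5/(1 - r x)\<^sup>2, x$5] :: complex^5)"
    for x :: "complex^5"
  have a0: "1 - x$1 \<noteq> 0" if "x \<in> U" for x using that by (auto simp: U_def)
  have r1: "Re (r x) < 1/2" if "x \<in> V" for x
    using csqrt_Re_pos[of "1 - 4 * (x$1 + x$2 * x$3)"] that by (simp add: V_def r_def)
  then have r0: "1 - r x \<noteq> 0" if "x \<in> V" for x using that by fastforce
  have rq: "r x * (1 - r x) = x$1 + x$2 * x$3" for x
    using power2_csqrt[of "1 - 4 * (x$1 + x$2 * x$3)"] unfolding r_def
    by (simp add: field_simps power2_eq_square)
  have hr: "holomorphic_fun_on r V" unfolding r_def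
    by (intro holomorphic_fun_on_intros) (auto simp: V_def)
  have sq: "1 - 4 * (quadric x + x$2 * x$3) = (1 - 2 * x$1)\<^sup>2" for x
    by (simp add: quadric_def power2_eq_square algebra_simps)
  have bi: "biholomorphism U V \<phi> \<psi>"
  proof (rule biholomorphismI)
    show "open U" unfolding U_def by (intro open_Collect_less continuous_intros)
    show "open V" unfolding V_def by (rule open_slit)
    show "holomorphic_map_on \<phi> U" unfolding \<phi>_def quadric_def
      by (intro holomorphic_map_on_vector_5 holomorphic_fun_on_intros; use a0 in simp)
    show "holomorphic_map_on \<psi> V" unfolding \<psi>_def
      by (intro holomorphic_map_on_vector_5 holomorphic_fun_on_intros hr; use r0 in simp)
    show "\<phi> x \<in> V \<and> \<psi> (\<phi> x) = x" if "x \<in> U" for x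
    proof -
      have pos: "0 < Re (1 - 2 * x$1)" using that by (simp add: U_def)
      have "csqrt ((1 - 2 * x$1)\<^sup>2) = 1 - 2 * x$1" using pos by (intro csqrt_square) auto
      moreover have "r (\<phi> x) = (1 - csqrt ((1 - 2 * x$1)\<^sup>2)) / 2"
        unfolding r_def \<phi>_def vector_5 sq ..
      ultimately have "r (\<phi> x) = x$1" by simp
      moreover have "\<phi> x \<in> V"
        using power2_notin_nonpos_Reals[OF pos] unfolding V_def \<phi>_def mem_Collect_eq vector_5 sq .
      ultimately show ?thesis by (simp add: \<psi>_def vec_eq_iff forall_5) (simp add: \<phi>_def)
    qed
    show "\<psi> z \<in> U \<and> \<phi> (\<psi> z) = z" if "z \<in> V" for z
      using r1[OF that] rq[of z] by (simp add: U_def \<phi>_def \<psi>_def vec_eq_iff forall_5 quadric_def)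
  qed
  have iff: "x \<in> threefold \<longleftrightarrow> \<phi> x \<in> {z. \<forall>i. i \<notin> {2,3,5} \<longrightarrow> z $ i = 0}" if "x \<in> U" for x
  proof -
    have a: "1 - x$1 \<noteq> 0" using a0[OF that] .
    have "sec00 x = 0" if q: "quadric x = 0" and s: "sec11 x = 0"
    proof -
      have "(1 - x$1)\<^sup>2 * sec00 x = (x$3)\<^sup>2 * sec11 x - x$5 * (x$1*(1 - x$1) + x$2*x$3) * quadric x"
        unfolding quadric_def sec_defs by algebra
      then show ?thesis using a q s by simp
    qed
    then have "x \<in> threefold \<longleftrightarrow> quadric x = 0 \<and> x$4 = (x$2)\<^sup>2*x$5/(1 - x$1)\<^sup>2"
      using a by (auto simp: threefold_def sec11_def eq_divide_eq algebra_simps)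
    then show ?thesis by (auto simp: forall_5 \<phi>_def)
  qed
  have "card {2,3,5::5} = 3" by simp
  moreover have "p \<in> U" using assms by (simp add: U_def)
  moreover have "\<phi> ` (threefold \<inter> U) = {z \<in> V. \<forall>i. i \<notin> {2,3,5} \<longrightarrow> z $ i = 0}"
    using biholomorphism_image_Int[OF bi iff] by auto
  ultimately show ?thesis using bi by blast
qed

lemma closed_complex_submanifold_threefold: "closed_complex_submanifold 3 threefold"
  unfolding closed_complex_submanifold_def
proof (intro conjI ballI closed_threefold)
  fix p :: "complex^5" assume p: "p \<in> threefold"
  \<comment> \<open>The half-spaces miss only the wall \<open>Re a = 1/2\<close>, where
    \<open>b c = a (1 - a)\<close> is nonzero and the chart with \<open>c \<noteq> 0\<close>
    applies.\<close>
  consider "1/2 < Re (p$1)" | "Re (p$1) < 1/2" | "Re (p$1) = 1/2" by linarith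
  then show "\<exists>U V \<phi> \<psi> I. p \<in> U \<and> biholomorphism U V \<phi> \<psi> \<and> card I = 3 \<and>
           \<phi> ` (threefold \<inter> U) = {z \<in> V. \<forall>i. i \<notin> I \<longrightarrow> z $ i = 0}"
  proof cases
    case 3
    have "p$3 \<noteq> 0"
    proof
      assume "p$3 = 0"
      then have "p$1 = 0 \<or> p$1 = 1"
        using p by (auto simp: threefold_def quadric_def)
      then show False using 3 by auto
    qed
    then show ?thesis by (rule threefold_chart_c)
  qed (use threefold_chart_a threefold_chart_1_minus_a in blast)+
qed

subsection \<open>Smooth defining functions\<close>

lemma Ck_fun_const: "Ck_fun k (\<lambda>x. c)"
  by (induction k arbitrary: c) auto

lemma Ck_fun_linear:
  assumes "bounded_linear f"
  shows "Ck_fun k f"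
proof (cases k)
  case 0
  then show ?thesis using assms by (simp add: linear_continuous_on)
next
  case (Suc n)
  have d: "(f has_derivative f) (at x)" for x
    using assms by (rule bounded_linear_imp_has_derivative)
  show ?thesis
    using d by (auto simp: Suc Ck_fun_const differentiable_def frechet_derivative_at[OF d, symmetric])
qed

lemma Ck_fun_lower: "Ck_fun (Suc k) f \<Longrightarrow> Ck_fun k f"
proof (induction k arbitrary: f)
  case 0
  then show ?case
    by (auto intro!: differentiable_imp_continuous_on simp: differentiable_on_def
        intro: differentiable_at_imp_differentiable_on)
next
  case (Suc k)
  then show ?case by simp
qed

lemma Ck_fun_add: "Ck_fun k f \<Longrightarrow> Ck_fun k g \<Longrightarrow> Ck_fun k (\<lambda>x. f x + g x)"
proof (induction k arbitrary: f g)
  case 0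
  then show ?case by (auto intro: continuous_on_add)
next
  case (Suc k)
  then have "frechet_derivative (\<lambda>x. f x + g x) (at x) =
      (\<lambda>v. frechet_derivative f (at x) v + frechet_derivative g (at x) v)" for x
    by (intro frechet_derivative_at[symmetric] has_derivative_add)
       (auto simp: frechet_derivative_works[symmetric])
  then show ?case using Suc by auto
qed

lemma Ck_fun_mult: "Ck_fun k f \<Longrightarrow> Ck_fun k g \<Longrightarrow> Ck_fun k (\<lambda>x. f x * g x)"
proof (induction k arbitrary: f g)
  case 0
  then show ?case by (auto intro: continuous_on_mult)
next
  case (Suc k)
  then have "frechet_derivative (\<lambda>x. f x * g x) (at x) =
      (\<lambda>v. f x * frechet_derivative g (at x) v + frechet_derivative f (at x) v * g x)" for x
    by (intro frechet_derivative_at[symmetric] has_derivative_mult)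
       (auto simp: frechet_derivative_works[symmetric])
  moreover have "Ck_fun k f" "Ck_fun k g" using Suc.prems Ck_fun_lower by blast+
  ultimately show ?case using Suc by (auto intro!: Ck_fun_add)
qed

lemma smooth_fun_const: "smooth_fun (\<lambda>x. c)"
  by (simp add: smooth_fun_def Ck_fun_const)

lemma smooth_fun_linear: "bounded_linear f \<Longrightarrow> smooth_fun f"
  by (simp add: smooth_fun_def Ck_fun_linear)

lemma smooth_fun_add: "smooth_fun f \<Longrightarrow> smooth_fun g \<Longrightarrow> smooth_fun (\<lambda>x. f x + g x)"
  by (simp add: smooth_fun_def Ck_fun_add)

lemma smooth_fun_mult: "smooth_fun f \<Longrightarrow> smooth_fun g \<Longrightarrow> smooth_fun (\<lambda>x. f x * g x)"
  by (simp add: smooth_fun_def Ck_fun_mult)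

lemma smooth_fun_diff: "smooth_fun f \<Longrightarrow> smooth_fun g \<Longrightarrow> smooth_fun (\<lambda>x. f x - g x)"
  using smooth_fun_add[OF _ smooth_fun_mult[OF smooth_fun_const], of f g "-1"] by simp

definition smooth_complex_fun :: "('a::euclidean_space \<Rightarrow> complex) \<Rightarrow> bool" where
  "smooth_complex_fun f \<longleftrightarrow> smooth_fun (\<lambda>x. Re (f x)) \<and> smooth_fun (\<lambda>x. Im (f x))"

lemma smooth_complex_fun_const: "smooth_complex_fun (\<lambda>x. c)"
  by (simp add: smooth_complex_fun_def smooth_fun_const)

lemma smooth_complex_fun_nth: "smooth_complex_fun (\<lambda>x::complex^'n. x $ i)"
  unfolding smooth_complex_fun_def
  by (intro conjI smooth_fun_linear bounded_linear_compose[OF bounded_linear_Re bounded_linear_vec_nth]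
      bounded_linear_compose[OF bounded_linear_Im bounded_linear_vec_nth])

lemma smooth_complex_fun_add:
  "smooth_complex_fun f \<Longrightarrow> smooth_complex_fun g \<Longrightarrow> smooth_complex_fun (\<lambda>x. f x + g x)"
  by (auto simp: smooth_complex_fun_def intro: smooth_fun_add)

lemma smooth_complex_fun_diff:
  "smooth_complex_fun f \<Longrightarrow> smooth_complex_fun g \<Longrightarrow> smooth_complex_fun (\<lambda>x. f x - g x)"
  by (auto simp: smooth_complex_fun_def intro: smooth_fun_diff)

lemma smooth_complex_fun_mult:
  "smooth_complex_fun f \<Longrightarrow> smooth_complex_fun g \<Longrightarrow> smooth_complex_fun (\<lambda>x. f x * g x)"
  by (auto simp: smooth_complex_fun_def intro: smooth_fun_add smooth_fun_diff smooth_fun_mult)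

lemma smooth_complex_fun_power:
  "smooth_complex_fun f \<Longrightarrow> smooth_complex_fun (\<lambda>x. f x ^ n)"
  by (induction n) (auto intro: smooth_complex_fun_const smooth_complex_fun_mult)

lemmas smooth_complex_fun_intros =
  smooth_complex_fun_const smooth_complex_fun_nth smooth_complex_fun_add smooth_complex_fun_diff
  smooth_complex_fun_mult smooth_complex_fun_power

text \<open>The quadric is the locus \<open>q \<bullet> q = 1\<close> for the complex vector \<open>q = (q1, q2, q3)\<close>. On it,
  \<open>T = (T1, T2, T3)\<close> is isotropic, orthogonal to \<open>q\<close>, and vanishes exactly on the threefold.\<close>

definition q1 :: "complex^5 \<Rightarrow> complex" where "q1 x = 2 * x$1 - 1"
definition q2 :: "complex^5 \<Rightarrow> complex" where "q2 x = x$2 + x$3"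
definition q3 :: "complex^5 \<Rightarrow> complex" where "q3 x = \<i> * (x$2 - x$3)"

definition T1 :: "complex^5 \<Rightarrow> complex" where "T1 x = 2 * sec01 x"
definition T2 :: "complex^5 \<Rightarrow> complex" where "T2 x = sec11 x - sec00 x"
definition T3 :: "complex^5 \<Rightarrow> complex" where "T3 x = \<i> * (sec00 x + sec11 x)"

lemmas q_defs = q1_def q2_def q3_def
lemmas T_defs = T1_def T2_def T3_def

text \<open>\<open>q\<close> consists of the Pauli coordinates of \<open>2 P - 1\<close>, whose
  determinant is \<open>- (q \<bullet> q)\<close>.\<close>

lemma q_square: "(q1 x)\<^sup>2 + (q2 x)\<^sup>2 + (q3 x)\<^sup>2 = 1 - 4 * quadric x"
  by (simp add: q_defs quadric_def power_mult_distrib) algebra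

text \<open>\<open>T\<close> follows the spinor parametrization
  \<open>(2 u0 u1, u1^2 - u0^2, \<i> (u0^2 + u1^2))\<close> of the isotropic cone, so its square is
  four times \<open>sec01^2 - sec00 sec11\<close>.\<close>

lemma T_square: "(T1 x)\<^sup>2 + (T2 x)\<^sup>2 + (T3 x)\<^sup>2 = 4 * x$4 * x$5 * (quadric x)\<^sup>2"
proof -
  have "(T1 x)\<^sup>2 + (T2 x)\<^sup>2 + (T3 x)\<^sup>2 = 4 * ((sec01 x)\<^sup>2 - sec00 x * sec11 x)"
    by (simp add: T_defs power_mult_distrib power2_eq_square algebra_simps)
  then show ?thesis by (simp add: sec01_square)
qed

text \<open>On the quadric, \<open>T\<close> gives the Pauli coordinates of \<open>2 s w u^T\<close>
  with \<open>w = (u1, - u0)\<close> in the kernel of \<open>P = v u^T\<close>. The product of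
  \<open>P\<close> with this traceless matrix is 0, so its trace pairing with \<open>2 P - 1\<close>
  vanishes.\<close>

lemma T_orthogonal_q:
  "T1 x * q1 x + T2 x * q2 x + T3 x * q3 x = 2 * (x$4 * x$3 + x$5 * x$2) * quadric x"
proof -
  have "T3 x * q3 x = - (sec00 x + sec11 x) * (x$2 - x$3)"
    by (simp add: T3_def q3_def algebra_simps)
  then show ?thesis
    unfolding T1_def T2_def q1_def q2_def sec_defs quadric_def by algebra
qed

lemma T_eq_0_iff:
  "T1 x = 0 \<and> T2 x = 0 \<and> T3 x = 0 \<longleftrightarrow> sec00 x = 0 \<and> sec01 x = 0 \<and> sec11 x = 0"
  by (auto simp: T_defs)


section \<open>Isotropic vectors in terms of real and imaginary parts\<close>

definition Re3 :: "complex \<Rightarrow> complex \<Rightarrow> complex \<Rightarrow> real^3" where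
  "Re3 z1 z2 z3 = vector [Re z1, Re z2, Re z3]"

definition Im3 :: "complex \<Rightarrow> complex \<Rightarrow> complex \<Rightarrow> real^3" where
  "Im3 z1 z2 z3 = vector [Im z1, Im z2, Im z3]"

lemma inner_vector_3: "x \<bullet> y = x$1 * y$1 + x$2 * y$2 + x$3 * y$3" for x y :: "real^3"
  by (simp add: inner_vec_def sum_3)

lemma Re_bilinear_3:
  "Re (z1 * w1 + z2 * w2 + z3 * w3) = Re3 z1 z2 z3 \<bullet> Re3 w1 w2 w3 - Im3 z1 z2 z3 \<bullet> Im3 w1 w2 w3"
  by (simp add: inner_vector_3 Re3_def Im3_def)

lemma Im_bilinear_3:
  "Im (z1 * w1 + z2 * w2 + z3 * w3) = Re3 z1 z2 z3 \<bullet> Im3 w1 w2 w3 + Im3 z1 z2 z3 \<bullet> Re3 w1 w2 w3"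
  by (simp add: inner_vector_3 Re3_def Im3_def)

lemma Re3_Im3_eq_0: "Re3 z1 z2 z3 = 0 \<and> Im3 z1 z2 z3 = 0 \<longleftrightarrow> z1 = 0 \<and> z2 = 0 \<and> z3 = 0"
  by (auto simp: Re3_def Im3_def vec_eq_iff forall_3 complex_eq_iff)

text \<open>The square of a triple product is the Gram determinant of its vectors, here with
  \<open>s\<close> and \<open>t\<close> orthogonal of equal length.\<close>

lemma triple_product_square:
  assumes "s \<bullet> t = 0" "s \<bullet> s = t \<bullet> t"
  shows "(cross3 x s \<bullet> t)\<^sup>2 = (s \<bullet> s) * (x \<bullet> x * (s \<bullet> s) - (x \<bullet> s)\<^sup>2 - (x \<bullet> t)\<^sup>2)"
proof -
  have "(cross3 x s \<bullet> t)\<^sup>2 = (x \<bullet> x) * (s \<bullet> s) * (t \<bullet> t) - (x \<bullet> x) * (s \<bullet> t)\<^sup>2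
    - (s \<bullet> s) * (x \<bullet> t)\<^sup>2 - (t \<bullet> t) * (x \<bullet> s)\<^sup>2 + 2 * (x \<bullet> s) * (x \<bullet> t) * (s \<bullet> t)"
    unfolding inner_vector_3 cross_components by algebra
  then show ?thesis using assms by (simp add: algebra_simps power2_eq_square)
qed

text \<open>Cramer's rule: up to the determinant, the cross products are the dual basis of
  \<open>x\<close>, \<open>s\<close>, \<open>t\<close>. A vector orthogonal to three independent
  vectors is therefore 0.\<close>

lemma triple_product_scaleR:
  "(cross3 x s \<bullet> t) *\<^sub>R d = (d \<bullet> x) *\<^sub>R cross3 s t + (d \<bullet> s) *\<^sub>R cross3 t x + (d \<bullet> t) *\<^sub>R cross3 x s"
  by (simp add: vec_eq_iff forall_3 inner_vector_3 cross_components algebra_simps)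

text \<open>For an isotropic \<open>s + i t\<close> orthogonal to \<open>x + i y\<close>, the projections of \<open>x\<close> and \<open>y\<close> to the
  plane of \<open>s\<close> and \<open>t\<close> have equal length, so the longer vector \<open>x\<close> is not in that plane.\<close>

lemma isotropic_triple_product_eq_0:
  assumes iso: "s \<bullet> t = 0" "s \<bullet> s = t \<bullet> t"
    and orth: "s \<bullet> x = t \<bullet> y" "s \<bullet> y + t \<bullet> x = 0"
    and len: "x \<bullet> x = y \<bullet> y + 1" and det: "cross3 x s \<bullet> t = 0"
  shows "s = 0 \<and> t = 0"
proof -
  have "(x \<bullet> s)\<^sup>2 = (y \<bullet> t)\<^sup>2" "(x \<bullet> t)\<^sup>2 = (y \<bullet> s)\<^sup>2"
    using orth by (auto simp: inner_commute power2_eq_iff)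
  \<comment> \<open>The Gram determinants for \<open>x\<close> and \<open>y\<close> differ only
    through \<open>x \<bullet> x = y \<bullet> y + 1\<close>.\<close>
  then have "(cross3 x s \<bullet> t)\<^sup>2 = (cross3 y s \<bullet> t)\<^sup>2 + (s \<bullet> s)\<^sup>2"
    unfolding triple_product_square[OF iso] len by (simp add: algebra_simps power2_eq_square)
  then have "(s \<bullet> s)\<^sup>2 \<le> 0" using det by (metis le_add_same_cancel2 power_zero_numeral zero_le_power2)
  then show ?thesis using iso by simp
qed

section \<open>The real defining functions and their zero set\<close>

abbreviation rq :: "complex^5 \<Rightarrow> real^3" where "rq x \<equiv> Re3 (q1 x) (q2 x) (q3 x)"
abbreviation iq :: "complex^5 \<Rightarrow> real^3" where "iq x \<equiv> Im3 (q1 x) (q2 x) (q3 x)"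
abbreviation rT :: "complex^5 \<Rightarrow> real^3" where "rT x \<equiv> Re3 (T1 x) (T2 x) (T3 x)"
abbreviation iT :: "complex^5 \<Rightarrow> real^3" where "iT x \<equiv> Im3 (T1 x) (T2 x) (T3 x)"

lemma rq_square: "rq x \<bullet> rq x = iq x \<bullet> iq x + 1 - 4 * Re (quadric x)"
  using arg_cong[OF q_square[of x], of Re] Re_bilinear_3[of "q1 x" "q1 x" "q2 x" "q2 x" "q3 x" "q3 x"]
  by (simp add: power2_eq_square)

text \<open>Over the quadric, \<open>rq x\<close>, \<open>rT x\<close>, \<open>iT x\<close> form a
  basis of real three-space unless \<open>T\<close> vanishes. This serves both the zero set and the
  independence of the differentials.\<close>

lemma T_eq_0:
  assumes "quadric x = 0" "cross3 (rq x) (rT x) \<bullet> iT x = 0"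
  shows "T1 x = 0 \<and> T2 x = 0 \<and> T3 x = 0"
proof -
  have sq: "T1 x * T1 x + T2 x * T2 x + T3 x * T3 x = 0"
    using T_square[of x] assms(1) by (simp add: power2_eq_square)
  have orth: "T1 x * q1 x + T2 x * q2 x + T3 x * q3 x = 0"
    using T_orthogonal_q[of x] assms(1) by simp
  have "rT x \<bullet> iT x = 0" "rT x \<bullet> rT x = iT x \<bullet> iT x"
    using arg_cong[OF sq, of Im] arg_cong[OF sq, of Re] unfolding Re_bilinear_3 Im_bilinear_3
    by (auto simp: inner_commute)
  moreover have "rT x \<bullet> rq x = iT x \<bullet> iq x" "rT x \<bullet> iq x + iT x \<bullet> rq x = 0"
    using arg_cong[OF orth, of Im] arg_cong[OF orth, of Re] unfolding Re_bilinear_3 Im_bilinear_3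
    by auto
  ultimately show ?thesis
    using isotropic_triple_product_eq_0[of "rT x" "iT x" "rq x" "iq x"] rq_square[of x] assms Re3_Im3_eq_0
    by simp
qed

definition normal_part :: "complex^5 \<Rightarrow> real^3" where
  "normal_part x = Im (quadric x) *\<^sub>R rq x + cross3 (rq x) (rT x)"

text \<open>The summands of \<open>normal_part\<close> are parallel and perpendicular to
  \<open>rq x\<close>, which is nonzero once \<open>Re (quadric x) = 0\<close>. Pairing with
  \<open>rq x\<close> isolates \<open>Im (quadric x)\<close>, and what remains is
  \<open>cross3 (rq x) (rT x) = 0\<close>.\<close>

lemma threefold_eq_zeros: "x \<in> threefold \<longleftrightarrow> Re (quadric x) = 0 \<and> normal_part x = 0"
proof
  assume "x \<in> threefold"
  then have "quadric x = 0" "T1 x = 0" "T2 x = 0" "T3 x = 0"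
    using T_eq_0_iff[of x] by (auto simp: threefold_iff)
  then show "Re (quadric x) = 0 \<and> normal_part x = 0"
    using Re3_Im3_eq_0[of 0 0 0] by (simp add: normal_part_def)
next
  assume *: "Re (quadric x) = 0 \<and> normal_part x = 0"
  have "rq x \<bullet> rq x > 0" using rq_square[of x] * by (simp add: add_nonneg_pos)
  moreover have "Im (quadric x) * (rq x \<bullet> rq x) = normal_part x \<bullet> rq x"
    by (simp add: normal_part_def inner_add_left dot_cross_self)
  ultimately have "Im (quadric x) = 0" using * by simp
  then have q: "quadric x = 0" using * by (simp add: complex_eq_iff)
  then have "cross3 (rq x) (rT x) = 0" using * by (simp add: normal_part_def)
  then show "x \<in> threefold"
    using T_eq_0[OF q] q T_eq_0_iff[of x] by (simp add: threefold_iff)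
qed

definition defining_fun :: "nat \<Rightarrow> complex^5 \<Rightarrow> real" where
  "defining_fun i x =
     [Re (quadric x), normal_part x $ 1, normal_part x $ 2, normal_part x $ 3] ! i"

lemma defining_fun_simps:
  "defining_fun 0 = (\<lambda>x. Re (quadric x))"
  "defining_fun (Suc 0) = (\<lambda>x. normal_part x $ 1)"
  "defining_fun (Suc (Suc 0)) = (\<lambda>x. normal_part x $ 2)"
  "defining_fun (Suc (Suc (Suc 0))) = (\<lambda>x. normal_part x $ 3)"
  by (auto simp: defining_fun_def)

lemma all_less_4: "(\<forall>i<4. P i) \<longleftrightarrow> P 0 \<and> P (Suc 0) \<and> P (Suc (Suc 0)) \<and> P (Suc (Suc (Suc 0)))"
  by (simp add: numeral_eq_Suc All_less_Suc) blast

lemma normal_part_components: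
  "normal_part x $ 1 = Im (quadric x) * Re (q1 x) + (Re (q2 x) * Re (T3 x) - Re (q3 x) * Re (T2 x))"
  "normal_part x $ 2 = Im (quadric x) * Re (q2 x) + (Re (q3 x) * Re (T1 x) - Re (q1 x) * Re (T3 x))"
  "normal_part x $ 3 = Im (quadric x) * Re (q3 x) + (Re (q1 x) * Re (T2 x) - Re (q2 x) * Re (T1 x))"
  by (simp_all add: normal_part_def cross_components Re3_def)

lemma smooth_complex_funs:
  "smooth_complex_fun quadric" "smooth_complex_fun q1" "smooth_complex_fun q2" "smooth_complex_fun q3"
  "smooth_complex_fun T1" "smooth_complex_fun T2" "smooth_complex_fun T3"
  unfolding quadric_def[abs_def] q_defs[abs_def] T_defs[abs_def] sec_defs[abs_def]
  by (intro smooth_complex_fun_intros)+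

lemma smooth_defining_fun: "i < 4 \<Longrightarrow> smooth_fun (defining_fun i)"
proof -
  have "\<forall>i<4. smooth_fun (defining_fun i)"
    unfolding all_less_4 defining_fun_simps normal_part_components
    using smooth_complex_funs unfolding smooth_complex_fun_def
    by (intro conjI smooth_fun_add smooth_fun_diff smooth_fun_mult) auto
  then show "i < 4 \<Longrightarrow> smooth_fun (defining_fun i)" by blast
qed

section \<open>Differentials of the defining functions\<close>

lemma has_derivative_vec_nth_id: "((\<lambda>x::complex^'n. x $ i) has_derivative (\<lambda>v. v $ i)) (at p)"
  by (intro bounded_linear_imp_has_derivative bounded_linear_vec_nth)

lemma has_derivative_quadric:
  "(quadric has_derivative (\<lambda>v. (1 - 2 * p$1) * v$1 - p$3 * v$2 - p$2 * v$3)) (at p)"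
  unfolding quadric_def[abs_def]
  by (auto intro!: derivative_eq_intros has_derivative_vec_nth_id simp: algebra_simps)

lemma has_derivative_sec:
  "(sec00 has_derivative (\<lambda>v. v$4 * (p$3)\<^sup>2 + 2 * p$4 * p$3 * v$3 - v$5 * (p$1)\<^sup>2 - 2 * p$5 * p$1 * v$1)) (at p)"
  "(sec01 has_derivative (\<lambda>v. v$4 * p$3 * (1 - p$1) + p$4 * (1 - p$1) * v$3 - p$4 * p$3 * v$1
      - v$5 * p$1 * p$2 - p$5 * p$2 * v$1 - p$5 * p$1 * v$2)) (at p)"
  "(sec11 has_derivative (\<lambda>v. v$4 * (1 - p$1)\<^sup>2 - 2 * p$4 * (1 - p$1) * v$1 - v$5 * (p$2)\<^sup>2
      - 2 * p$5 * p$2 * v$2)) (at p)"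
  unfolding sec_defs[abs_def]
  by (auto intro!: derivative_eq_intros has_derivative_vec_nth_id simp: algebra_simps power2_eq_square)

text \<open>\<open>T\<close> is linear in the fibre coordinates \<open>(w0, w1)\<close>, so its
  vertical derivative is \<open>T\<close> itself evaluated over the same base point.\<close>

lemma has_derivative_T_vertical:
  "\<exists>T1' T2' T3'. (T1 has_derivative T1') (at p) \<and> (T2 has_derivative T2') (at p) \<and>
     (T3 has_derivative T3') (at p) \<and>
     (\<forall>s t. T1' (vector [0, 0, 0, s, t]) = T1 (vector [p$1, p$2, p$3, s, t]) \<and>
            T2' (vector [0, 0, 0, s, t]) = T2 (vector [p$1, p$2, p$3, s, t]) \<and>
            T3' (vector [0, 0, 0, s, t]) = T3 (vector [p$1, p$2, p$3, s, t]))"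
proof -
  note d1 = has_derivative_mult_right[OF has_derivative_sec(2), of 2 p]
  note d2 = has_derivative_diff[OF has_derivative_sec(3) has_derivative_sec(1), of p]
  note d3 = has_derivative_mult_right[OF has_derivative_add[OF has_derivative_sec(1) has_derivative_sec(3)],
      of \<i> p]
  show ?thesis
    by (rule exI conjI d1[folded T1_def[abs_def]] d2[folded T2_def[abs_def]] d3[folded T3_def[abs_def]])+
       (simp add: T_defs sec_defs)
qed

lemma has_derivative_Re: "(f has_derivative f') F \<Longrightarrow> ((\<lambda>x. Re (f x)) has_derivative (\<lambda>v. Re (f' v))) F"
  by (rule bounded_linear.has_derivative[OF bounded_linear_Re])

lemma has_derivative_Im: "(f has_derivative f') F \<Longrightarrow> ((\<lambda>x. Im (f x)) has_derivative (\<lambda>v. Im (f' v))) F"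
  by (rule bounded_linear.has_derivative[OF bounded_linear_Im])

text \<open>As \<open>quadric\<close> and \<open>T\<close> vanish at \<open>p\<close>, the product
  rule leaves no term in which \<open>rq\<close> is differentiated.\<close>

lemma has_derivative_normal_part:
  assumes "quadric p = 0" "T1 p = 0" "T2 p = 0" "T3 p = 0"
    and h: "(quadric has_derivative h') (at p)"
    and T: "(T1 has_derivative T1') (at p)" "(T2 has_derivative T2') (at p)" "(T3 has_derivative T3') (at p)"
  defines "N' \<equiv> \<lambda>v. Im (h' v) *\<^sub>R rq p + cross3 (rq p) (Re3 (T1' v) (T2' v) (T3' v))"
  shows "((\<lambda>x. normal_part x $ 1) has_derivative (\<lambda>v. N' v $ 1)) (at p)"
    "((\<lambda>x. normal_part x $ 2) has_derivative (\<lambda>v. N' v $ 2)) (at p)"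
    "((\<lambda>x. normal_part x $ 3) has_derivative (\<lambda>v. N' v $ 3)) (at p)"
proof -
  have q: "(q1 has_derivative (\<lambda>v. 2 * v$1)) (at p)" "(q2 has_derivative (\<lambda>v. v$2 + v$3)) (at p)"
    "(q3 has_derivative (\<lambda>v. \<i> * (v$2 - v$3))) (at p)"
    unfolding q_defs[abs_def]
    by (auto intro!: derivative_eq_intros has_derivative_vec_nth_id simp: algebra_simps)
  note d = q[THEN has_derivative_Re] T[THEN has_derivative_Re] h[THEN has_derivative_Im]
  show "((\<lambda>x. normal_part x $ 1) has_derivative (\<lambda>v. N' v $ 1)) (at p)"
    "((\<lambda>x. normal_part x $ 2) has_derivative (\<lambda>v. N' v $ 2)) (at p)"
    "((\<lambda>x. normal_part x $ 3) has_derivative (\<lambda>v. N' v $ 3)) (at p)"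
    unfolding normal_part_components
    by (rule has_derivative_eq_rhs, (rule has_derivative_add has_derivative_diff has_derivative_mult d)+,
        simp add: assms(1-4) N'_def cross_components Re3_def ac_simps)+
qed

text \<open>The vertical vectors \<open>(0, 1)\<close> and \<open>(1, 0)\<close> give
  \<open>sec00 = - a^2\<close> and \<open>sec11 = (1 - a)^2\<close>, which cannot both be 0.\<close>

lemma T_vertical_nonzero:
  assumes "quadric p = 0"
  shows "\<exists>s t. T1 (vector [p$1, p$2, p$3, s, t]) \<noteq> 0 \<or> T2 (vector [p$1, p$2, p$3, s, t]) \<noteq> 0 \<or>
    T3 (vector [p$1, p$2, p$3, s, t]) \<noteq> 0"
proof (rule ccontr)
  assume "\<not> ?thesis"
  then have *: "sec00 (vector [p$1, p$2, p$3, s, t]) = 0 \<and> sec11 (vector [p$1, p$2, p$3, s, t]) = 0" for s t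
    using T_eq_0_iff by metis
  have "p$1 = 0" using *[of 0 1] by (simp add: sec_defs)
  moreover have "p$1 = 1" using *[of 1 0] by (simp add: sec_defs)
  ultimately show False by simp
qed

lemma T_vertical_times_ii:
  "T1 (vector [a, b, c, \<i> * s, \<i> * t]) = \<i> * T1 (vector [a, b, c, s, t])"
  "T2 (vector [a, b, c, \<i> * s, \<i> * t]) = \<i> * T2 (vector [a, b, c, s, t])"
  "T3 (vector [a, b, c, \<i> * s, \<i> * t]) = \<i> * T3 (vector [a, b, c, s, t])"
  by (simp_all add: T_defs sec_defs algebra_simps)

lemma differentiable_complete_intersection_threefold:
  "differentiable_complete_intersection 4 threefold"
  unfolding differentiable_complete_intersection_def
proof (intro exI[of _ defining_fun] conjI allI impI ballI)
  show "smooth_fun (defining_fun i)" if "i < 4" for i using that by (rule smooth_defining_fun)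
  have "(\<forall>i<4. defining_fun i x = 0) \<longleftrightarrow> x \<in> threefold" for x
    unfolding all_less_4 defining_fun_simps threefold_eq_zeros by (auto simp: vec_eq_iff forall_3)
  then show "threefold = {x. \<forall>i<4. defining_fun i x = 0}" by blast
next
  fix p and c :: "nat \<Rightarrow> real"
  assume p: "p \<in> threefold"
    and c: "\<forall>v. (\<Sum>i<4. c i * frechet_derivative (defining_fun i) (at p) v) = 0"
  have q0: "quadric p = 0" and T0: "T1 p = 0" "T2 p = 0" "T3 p = 0"
    using p T_eq_0_iff[of p] by (auto simp: threefold_iff)
  obtain T1' T2' T3' where T': "(T1 has_derivative T1') (at p)" "(T2 has_derivative T2') (at p)"
    "(T3 has_derivative T3') (at p)"
    and vert: "\<And>s t. T1' (vector [0, 0, 0, s, t]) = T1 (vector [p$1, p$2, p$3, s, t])"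
      "\<And>s t. T2' (vector [0, 0, 0, s, t]) = T2 (vector [p$1, p$2, p$3, s, t])"
      "\<And>s t. T3' (vector [0, 0, 0, s, t]) = T3 (vector [p$1, p$2, p$3, s, t])"
    using has_derivative_T_vertical[of p] by blast
  define h' where "h' = (\<lambda>v::complex^5. (1 - 2 * p$1) * v$1 - p$3 * v$2 - p$2 * v$3)"
  have h: "(quadric has_derivative h') (at p)"
    unfolding h'_def by (rule has_derivative_quadric)
  define k :: "real^3" where "k = vector [c (Suc 0), c (Suc (Suc 0)), c (Suc (Suc (Suc 0)))]"
  define R where "R v = Re3 (T1' v) (T2' v) (T3' v)" for v
  note N = has_derivative_normal_part[OF q0 T0 h T']
  have lin: "c 0 * Re (h' v) + Im (h' v) * (k \<bullet> rq p) + cross3 k (rq p) \<bullet> R v = 0" for v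
  proof -
    have "{..<4::nat} = {0, Suc 0, Suc (Suc 0), Suc (Suc (Suc 0))}" by auto
    then have "0 = (\<Sum>i\<in>{0, Suc 0, Suc (Suc 0), Suc (Suc (Suc 0))}.
        c i * frechet_derivative (defining_fun i) (at p) v)"
      using c by simp
    also have "\<dots> = c 0 * Re (h' v) + k \<bullet> (Im (h' v) *\<^sub>R rq p + cross3 (rq p) (R v))"
      unfolding defining_fun_simps R_def inner_vector_3 k_def
      by (simp add: defining_fun_simps frechet_derivative_at[OF has_derivative_Re[OF h], symmetric]
          N[THEN frechet_derivative_at, symmetric])
    also have "k \<bullet> cross3 (rq p) (R v) = cross3 k (rq p) \<bullet> R v"
      by (simp add: inner_vector_3 cross_components algebra_simps)
    then have "c 0 * Re (h' v) + k \<bullet> (Im (h' v) *\<^sub>R rq p + cross3 (rq p) (R v)) =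
        c 0 * Re (h' v) + Im (h' v) * (k \<bullet> rq p) + cross3 k (rq p) \<bullet> R v"
      by (simp add: inner_add_right)
    finally show ?thesis by simp
  qed
  \<comment> \<open>Vertical vectors are killed by \<open>h'\<close>. Testing \<open>(s, t)\<close>
    and \<open>\<i> (s, t)\<close> makes \<open>cross3 k (rq p)\<close> orthogonal to
    \<open>rT p'\<close> and \<open>iT p'\<close> for a point \<open>p'\<close> of the same fibre
    with nonzero \<open>T\<close>. It is also orthogonal to \<open>rq p\<close>, and these three
    vectors form a basis.\<close>
  have par: "cross3 k (rq p) = 0"
  proof (rule ccontr)
    assume nz: "cross3 k (rq p) \<noteq> 0"
    obtain s t where st: "T1 (vector [p$1, p$2, p$3, s, t]) \<noteq> 0 \<or> T2 (vector [p$1, p$2, p$3, s, t]) \<noteq> 0 \<or>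
      T3 (vector [p$1, p$2, p$3, s, t]) \<noteq> 0"
      using T_vertical_nonzero[OF q0] by blast
    define p' where "p' = (vector [p$1, p$2, p$3, s, t] :: complex^5)"
    have same: "quadric p' = 0" "rq p' = rq p"
      using q0 by (simp_all add: p'_def quadric_def q_defs)
    have "cross3 k (rq p) \<bullet> rT p' = 0"
      using lin[of "vector [0, 0, 0, s, t]"] by (simp add: h'_def R_def vert p'_def)
    moreover have "cross3 k (rq p) \<bullet> iT p' = 0"
      using lin[of "vector [0, 0, 0, \<i> * s, \<i> * t]"]
      by (simp add: h'_def R_def vert p'_def T_vertical_times_ii Re3_def Im3_def inner_vector_3)
    ultimately have "(cross3 (rq p) (rT p') \<bullet> iT p') *\<^sub>R cross3 k (rq p) = 0"
      by (simp add: triple_product_scaleR dot_cross_self)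
    then have "cross3 (rq p') (rT p') \<bullet> iT p' = 0" using nz same by simp
    then show False using T_eq_0[OF same(1)] st by (simp add: p'_def)
  qed
  \<comment> \<open>In the coordinates \<open>q\<close> this is the radial direction
    \<open>- 2 r q\<close>. Since \<open>q \<bullet> q = 1 - 4 quadric\<close>, the derivative of
    \<open>quadric\<close> along it is \<open>r\<close>; the values 1 and \<open>\<i>\<close>
    isolate \<open>c 0\<close> and \<open>k \<bullet> rq p\<close>.\<close>
  define n where "n r = (vector [r * (1 - 2 * p$1), - 2 * r * p$2, - 2 * r * p$3, 0, 0] :: complex^5)" for r
  have hn: "h' (n r) = r" for r
  proof -
    have "h' (n r) = r * (1 - 4 * quadric p)"
      by (simp add: h'_def n_def quadric_def algebra_simps)
    then show ?thesis using q0 by simp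
  qed
  have c0: "c 0 = 0" using lin[of "n 1"] par hn[of 1] by simp
  have kx: "k \<bullet> rq p = 0" using lin[of "n \<i>"] par hn[of \<i>] by simp
  have "rq p \<bullet> rq p > 0" using rq_square[of p] q0 by (simp add: add_nonneg_pos)
  moreover have "(rq p \<bullet> rq p) *\<^sub>R k = 0"
    using Lagrange[of "rq p" k "rq p"] par kx by (simp add: inner_commute)
  ultimately have "k = 0" by auto
  then have "\<forall>i<4. c i = 0"
    unfolding all_less_4 using c0 by (simp add: k_def vec_eq_iff forall_3)
  then show "\<And>i. i < 4 \<Longrightarrow> c i = 0" by blast
qed

subsection \<open>Nonexistence of holomorphic defining functions\<close>

lemma bounded_linear_vector_scalar_mult: "bounded_linear (\<lambda>z. z *s (m::complex^'n))"
  unfolding linear_conv_bounded_linear[symmetric]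
  by (rule linearI) (simp_all add: vec_eq_iff algebra_simps)

lemma continuous_on_vector_scalar_mult:
  "continuous_on S g \<Longrightarrow> continuous_on S (\<lambda>x. g x *s (m::complex^'n))"
  by (rule bounded_linear.continuous_on[OF bounded_linear_vector_scalar_mult])

lemma holomorphic_fun_on_frechet_derivative:
  assumes "holomorphic_fun_on f U" "x \<in> U"
  shows "(f has_derivative frechet_derivative f (at x)) (at x)"
    and "frechet_derivative f (at x) (c *s v) = c * frechet_derivative f (at x) v"
    and "linear (frechet_derivative f (at x))"
proof -
  obtain f' where "(f has_derivative f') (at x)" "\<forall>c v. f' (c *s v) = c * f' v"
    using assms unfolding holomorphic_fun_on_def by blast
  then show "(f has_derivative frechet_derivative f (at x)) (at x)"
    "frechet_derivative f (at x) (c *s v) = c * frechet_derivative f (at x) v"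
    "linear (frechet_derivative f (at x))"
    using frechet_derivative_at[of f f' x] has_derivative_linear by auto
qed

lemma has_field_derivative_along_complex_line:
  assumes "holomorphic_fun_on f UNIV"
  shows "((\<lambda>z. f (p + z *s m)) has_field_derivative frechet_derivative f (at (p + z *s m)) m) (at z)"
proof -
  have "((\<lambda>z. p + z *s m) has_derivative (\<lambda>z. z *s m)) (at z)"
    using has_derivative_add[OF has_derivative_const
        bounded_linear_imp_has_derivative[OF bounded_linear_vector_scalar_mult]] by simp
  from has_derivative_compose[OF this holomorphic_fun_on_frechet_derivative(1)[OF assms UNIV_I]]
  show ?thesis
    by (simp add: has_field_derivative_def holomorphic_fun_on_frechet_derivative(2)[OF assms UNIV_I]
        mult_commute_abs)
qed

lemma frechet_derivative_eq_0_along_complex_line: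
  assumes "holomorphic_fun_on f UNIV" "\<And>z. f (p + z *s m) = 0"
  shows "frechet_derivative f (at p) m = 0"
proof -
  have "((\<lambda>z. 0) has_field_derivative frechet_derivative f (at p) m) (at 0)"
    using has_field_derivative_along_complex_line[OF assms(1), of p m 0] assms(2) by simp
  then show ?thesis by (metis DERIV_const DERIV_unique)
qed

text \<open>Holomorphy is assumed only as pointwise complex differentiability. Cauchy's formula on
  the unit circle of the line through \<open>x\<close> in direction \<open>m\<close> writes the
  derivative as an integral of values of \<open>f\<close>, which depends continuously on
  \<open>x\<close>.\<close>

lemma continuous_on_frechet_derivative_direction:
  assumes f: "holomorphic_fun_on f UNIV"
  shows "continuous_on UNIV (\<lambda>x. frechet_derivative f (at x) m)"
proof -
  define c where "c = circlepath 0 1"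
  define k where "k x t = f (x + c t *s m) / (c t)\<^sup>2 * (2 * pi * \<i> * exp (2 * of_real pi * \<i> * of_real t))"
    for x t
  have contf: "continuous_on UNIV f"
    using f by (rule holomorphic_fun_on_imp_continuous_on)
  have cauchy: "frechet_derivative f (at x) m = 1 / (2 * of_real pi * \<i>) * integral {0..1} (k x)" for x
  proof -
    have hol: "(\<lambda>z. f (x + z *s m)) holomorphic_on UNIV"
      using has_field_derivative_along_complex_line[OF f] by (auto simp: holomorphic_on_open)
    have "((\<lambda>z. f (x + z *s m)) has_field_derivative (1 / (2 * of_real pi * \<i>) *
        contour_integral (circlepath 0 1) (\<lambda>u. f (x + u *s m) / (u - 0)\<^sup>2))) (at 0)"
      by (rule Cauchy_derivative_integral_circlepath(2))
         (auto intro: holomorphic_on_imp_continuous_on holomorphic_on_subset[OF hol])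
    moreover have "contour_integral (circlepath 0 1) (\<lambda>u. f (x + u *s m) / (u - 0)\<^sup>2) = integral {0..1} (k x)"
      by (simp add: contour_integral_integral vector_derivative_circlepath k_def[abs_def] c_def)
    ultimately show ?thesis
      using has_field_derivative_along_complex_line[OF f, of x m 0] DERIV_unique by fastforce
  qed
  have c: "continuous_on S c" "c t \<noteq> 0" for S t
    unfolding c_def circlepath by (auto intro!: continuous_intros)
  have "continuous_on (UNIV \<times> cbox 0 1) (\<lambda>(x, t). k x t)"
    unfolding k_def case_prod_unfold
    by (intro continuous_intros continuous_on_vector_scalar_mult continuous_on_compose2[OF contf]
        continuous_on_compose2[OF c(1)[of UNIV]]) (auto simp: c(2))
  then have "continuous_on UNIV (\<lambda>x. integral (cbox 0 1) (k x))"
    by (rule integral_continuous_on_param)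
  then show ?thesis unfolding cauchy by (intro continuous_intros) simp
qed

lemma continuous_on_frechet_derivative:
  assumes f: "holomorphic_fun_on f UNIV" and p: "continuous_on S p" and u: "continuous_on S u"
  shows "continuous_on S (\<lambda>s. frechet_derivative f (at (p s)) (u s))"
proof -
  have "frechet_derivative f (at x) v = (\<Sum>i\<in>UNIV. v $ i * frechet_derivative f (at x) (axis i 1))" for x v
  proof -
    have "frechet_derivative f (at x) (\<Sum>i\<in>UNIV. v $ i *s axis i 1) =
        (\<Sum>i\<in>UNIV. v $ i * frechet_derivative f (at x) (axis i 1))"
      by (simp add: linear_sum[OF holomorphic_fun_on_frechet_derivative(3)[OF f UNIV_I]]
          holomorphic_fun_on_frechet_derivative(2)[OF f UNIV_I])
    then show ?thesis by (simp add: basis_expansion)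
  qed
  note eq = this
  show ?thesis
    by (subst eq) (intro continuous_intros u
        continuous_on_compose2[OF continuous_on_frechet_derivative_direction[OF f] p] subset_UNIV)
qed

section \<open>The winding number obstruction\<close>

lemma continuous_on_exp_constant:
  fixes u :: "'a::topological_space \<Rightarrow> complex"
  assumes "connected S" "continuous_on S u" "\<And>x. x \<in> S \<Longrightarrow> exp (u x) = c"
  shows "u constant_on S"
proof (rule continuous_discrete_range_constant[OF assms(1,2)])
  fix x assume x: "x \<in> S"
  have "2 * pi \<le> norm (u y - u x)" if y: "y \<in> S" "u y \<noteq> u x" for y
  proof -
    have "exp (u y) = exp (u x)" using assms(3) x y by simp
    then obtain n :: int where n: "u y = u x + (of_int (2 * n) * pi) * \<i>"
      unfolding exp_eq by blast
    then have "n \<noteq> 0" using y by auto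
    then have "1 \<le> \<bar>real_of_int n\<bar>" by linarith
    then show ?thesis using n by (simp add: norm_mult abs_mult)
  qed
  then show "\<exists>e>0. \<forall>y. y \<in> S \<and> u y \<noteq> u x \<longrightarrow> e \<le> norm (u y - u x)"
    using pi_gt_zero by (intro exI[of _ "2 * pi"]) auto
qed

text \<open>On a circle orbit, such a function would have winding number \<open>-2\<close>, although the orbit is
  null-homotopic in the three-sphere.\<close>

lemma no_nonvanishing_weight_2_on_sphere:
  fixes E :: "complex \<times> complex \<Rightarrow> complex"
  assumes cont: "continuous_on (sphere 0 1) E" and nz: "\<And>v. v \<in> sphere 0 1 \<Longrightarrow> E v \<noteq> 0"
    and weight: "\<And>x y t. (x, y) \<in> sphere 0 1 \<Longrightarrow> E (cis t * x, cis t * y) = cis (- 2 * t) * E (x, y)"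
  shows False
proof -
  have "simply_connected (sphere (0 :: complex \<times> complex) 1)"
    by (rule simply_connected_sphere) simp
  then obtain g where g: "continuous_on (sphere 0 1) g" "\<And>v. v \<in> sphere 0 1 \<Longrightarrow> E v = exp (g v)"
    using continuous_logarithm_on_simply_connected[OF cont _ locally_path_connected_sphere nz] by blast
  have orbit: "(cis t, 0) \<in> sphere (0 :: complex \<times> complex) 1" for t
    by (simp add: norm_Pair)
  \<comment> \<open>The weight makes \<open>exp (u t)\<close> constant, hence also \<open>u\<close>;
    but \<open>g\<close> returns to its value after a full turn while the added term grows by
    \<open>4 pi \<i>\<close>.\<close>
  define u where "u t = g (cis t, 0) + 2 * \<i> * of_real t" for t
  have "continuous_on {0..2*pi} u"
    unfolding u_def using orbit
    by (intro continuous_intros continuous_on_compose2[OF g(1)]) auto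
  moreover have "exp (u t) = E (1, 0)" for t
  proof -
    have "exp (u t) = E (cis t * 1, cis t * 0) * cis (2 * t)"
      using g(2)[OF orbit, of t] by (simp add: u_def exp_add cis_conv_exp ac_simps)
    also have "\<dots> = E (1, 0)"
      using weight[of 1 0 t] by (simp add: norm_Pair cis_mult mult.commute[of _ "E (1, 0)"] mult.assoc)
    finally show ?thesis .
  qed
  ultimately have "u constant_on {0..2*pi}"
    by (intro continuous_on_exp_constant) auto
  then have "u 0 = u (2 * pi)"
    unfolding constant_on_def by (metis atLeastAtMost_iff pi_ge_zero mult_nonneg_nonneg order_refl zero_le_numeral)
  then show False by (simp add: u_def)
qed

text \<open>For a unit vector \<open>v = (x, y)\<close>, \<open>pt v\<close> is the orthogonal projection \<open>v v\<^sup>*\<close> onto the line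
  of \<open>v\<close>; the vectors \<open>tangent1\<close>, \<open>tangent2\<close>, \<open>tangent3\<close> span the tangent space there, and
  \<open>normal1\<close>, \<open>normal2\<close> a complement.\<close>

definition pt :: "complex \<times> complex \<Rightarrow> complex^5" where
  "pt = (\<lambda>(x, y). vector [x * cnj x, x * cnj y, cnj x * y, 0, 0])"
definition normal1 :: "complex \<times> complex \<Rightarrow> complex^5" where
  "normal1 = (\<lambda>(x, y). vector [x * cnj x - y * cnj y, 2 * x * cnj y, 2 * cnj x * y, 0, 0])"
definition normal2 :: "complex \<times> complex \<Rightarrow> complex^5" where
  "normal2 = (\<lambda>(x, y). vector [0, 0, 0, (cnj y)\<^sup>2, - (cnj x)\<^sup>2])"
definition tangent1 :: "complex \<times> complex \<Rightarrow> complex^5" where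
  "tangent1 = (\<lambda>(x, y). vector [- cnj x * cnj y, - (cnj y)\<^sup>2, (cnj x)\<^sup>2, 0, 0])"
definition tangent2 :: "complex \<times> complex \<Rightarrow> complex^5" where
  "tangent2 = (\<lambda>(x, y). vector [- x * y, x\<^sup>2, - y\<^sup>2, 0, 0])"
definition tangent3 :: "complex \<times> complex \<Rightarrow> complex^5" where
  "tangent3 = (\<lambda>(x, y). vector [0, 0, 0, x\<^sup>2, y\<^sup>2])"

section \<open>Tangent and normal frame along the two-sphere\<close>

lemma sphere_pair_iff: "(x, y) \<in> sphere (0 :: complex \<times> complex) 1 \<longleftrightarrow> x * cnj x + y * cnj y = 1"
proof -
  have "x * cnj x + y * cnj y = of_real ((norm x)\<^sup>2 + (norm y)\<^sup>2)"
    by (simp only: complex_norm_square[symmetric] of_real_add)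
  then show ?thesis
    by (simp only: of_real_eq_1_iff) (simp add: norm_Pair)
qed

text \<open>The first two lines are the rulings of the quadric through \<open>v v^*\<close>, moving
  one factor while the other is fixed, inside the zero section; the third is the fibre. A function
  vanishing on the threefold thus has zero derivative in these directions.\<close>

lemma tangent_lines_in_threefold:
  assumes "v \<in> sphere 0 1"
  shows "pt v + z *s tangent1 v \<in> threefold" "pt v + z *s tangent2 v \<in> threefold"
    "pt v + z *s tangent3 v \<in> threefold"
proof -
  obtain x y where v: "v = (x, y)" by (cases v)
  have 1: "x * cnj x + y * cnj y = 1" using assms unfolding v sphere_pair_iff .
  then show "pt v + z *s tangent1 v \<in> threefold" "pt v + z *s tangent2 v \<in> threefold"
    "pt v + z *s tangent3 v \<in> threefold"
    unfolding v threefold_def mem_Collect_eq quadric_def sec_defs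
    by (simp_all add: pt_def tangent1_def tangent2_def tangent3_def) algebra+
qed

lemma pt_frame_spans:
  assumes "v \<in> sphere 0 1"
  obtains a1 a2 a3 b1 b2 where
    "u = a1 *s tangent1 v + a2 *s tangent2 v + a3 *s tangent3 v + b1 *s normal1 v + b2 *s normal2 v"
proof -
  obtain x y where v: "v = (x, y)" by (cases v)
  have 1: "x * cnj x + y * cnj y = 1" using assms unfolding v sphere_pair_iff .
  define n where "n = (x * cnj x)\<^sup>2 + (y * cnj y)\<^sup>2"
  have "n = of_real ((norm x)^4 + (norm y)^4)"
    unfolding n_def complex_norm_square[symmetric] by (simp flip: of_real_power power_mult)
  moreover have "(norm x)^4 + (norm y)^4 \<noteq> 0"
  proof
    assume "(norm x)^4 + (norm y)^4 = 0"
    moreover have "0 \<le> (norm x)^4" "0 \<le> (norm y)^4" by simp_all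
    ultimately have "(norm x)^4 = 0" "(norm y)^4 = 0" by linarith+
    then show False using 1 by simp
  qed
  ultimately have n: "n \<noteq> 0" using of_real_eq_0_iff by metis
  show thesis
  proof (rule that)
    \<comment> \<open>The first three coordinates form a traceless matrix, whose entries in the
      unitary basis \<open>(x, y)\<close>, \<open>(- cnj y, cnj x)\<close> are the coefficients. The
      last two are projected onto the Hermitian orthogonal vectors \<open>(x^2, y^2)\<close> and
      \<open>((cnj y)^2, - (cnj x)^2)\<close>, both of squared length \<open>n\<close>.\<close>
    show "u = (- y * (u$1 * x + u$2 * y) + x * (u$3 * x - u$1 * y)) *s tangent1 v
        + (cnj x * (u$2 * cnj x - u$1 * cnj y) - cnj y * (u$3 * cnj y + u$1 * cnj x)) *s tangent2 v
        + (((cnj x)\<^sup>2 * u$4 + (cnj y)\<^sup>2 * u$5) / n) *s tangent3 v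
        + (cnj x * (u$1 * x + u$2 * y) + cnj y * (u$3 * x - u$1 * y)) *s normal1 v
        + ((y\<^sup>2 * u$4 - x\<^sup>2 * u$5) / n) *s normal2 v"
      unfolding vec_eq_iff forall_5 v
    proof (intro conjI, goal_cases)
      case 1
      then show ?case using \<open>x * cnj x + y * cnj y = 1\<close>
        by (simp add: tangent1_def tangent2_def tangent3_def normal1_def normal2_def) algebra
    next
      case 2
      then show ?case using \<open>x * cnj x + y * cnj y = 1\<close>
        by (simp add: tangent1_def tangent2_def tangent3_def normal1_def normal2_def) algebra
    next
      case 3
      then show ?case using \<open>x * cnj x + y * cnj y = 1\<close>
        by (simp add: tangent1_def tangent2_def tangent3_def normal1_def normal2_def) algebra
    next
      case 4
      then show ?case using n
        by (simp add: tangent1_def tangent2_def tangent3_def normal1_def normal2_def divide_simps)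
           (simp add: n_def power2_eq_square algebra_simps)
    next
      case 5
      then show ?case using n
        by (simp add: tangent1_def tangent2_def tangent3_def normal1_def normal2_def divide_simps)
           (simp add: n_def power2_eq_square algebra_simps)
    qed
  qed
qed

lemma singular_2x2_left_kernel:
  fixes a1 a2 b1 b2 :: "'a::field"
  assumes "a1 * b2 - a2 * b1 = 0"
  obtains c1 c2 where "c1 \<noteq> 0 \<or> c2 \<noteq> 0" "c1 * a1 + c2 * a2 = 0" "c1 * b1 + c2 * b2 = 0"
proof (cases "a1 = 0 \<and> a2 = 0")
  case True
  then show ?thesis
    using that[of 1 0] that[of b2 "- b1"] by (cases "b1 = 0 \<and> b2 = 0") (auto simp: algebra_simps)
next
  case False
  then show ?thesis
    using assms by (intro that[of a2 "- a1"]) (auto simp: algebra_simps)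
qed

lemma continuous_on_vector_5:
  fixes a b c d e :: "'a::topological_space \<Rightarrow> complex"
  assumes "continuous_on S a" "continuous_on S b" "continuous_on S c" "continuous_on S d" "continuous_on S e"
  shows "continuous_on S (\<lambda>x. vector [a x, b x, c x, d x, e x] :: complex^5)"
proof -
  have "continuous_on S (\<lambda>x. \<chi> i. (vector [a x, b x, c x, d x, e x] :: complex^5) $ i)"
    by (rule continuous_on_vec_lambda, rename_tac i, cut_tac x = i in exhaust_5) (use assms in auto)
  then show ?thesis by simp
qed

lemma not_holomorphic_complete_intersection_threefold:
  "\<not> holomorphic_complete_intersection 2 threefold"
proof
  assume "holomorphic_complete_intersection 2 threefold"
  then obtain f :: "nat \<Rightarrow> complex^5 \<Rightarrow> complex" where
    hol: "\<And>i. i < 2 \<Longrightarrow> holomorphic_fun_on (f i) UNIV"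
    and zeros: "threefold = {x. \<forall>i<2. f i x = 0}"
    and indep: "\<And>x c. x \<in> threefold \<Longrightarrow>
      (\<forall>v. (\<Sum>i<2. c i * frechet_derivative (f i) (at x) v) = 0) \<Longrightarrow> \<forall>i<2. c i = 0"
    unfolding holomorphic_complete_intersection_def by blast
  have two: "{..<2::nat} = {0, 1}" by auto
  define D where "D i v = frechet_derivative (f i) (at (pt v))" for i v
  \<comment> \<open>The determinant of the two differentials on the normal frame. Both kill the
    tangent directions, so a zero of \<open>E\<close> would make them dependent.\<close>
  define E where "E v = D 0 v (normal1 v) * D 1 v (normal2 v) - D 1 v (normal1 v) * D 0 v (normal2 v)" for v
  have D_scale: "D i v (c *s u) = c * D i v u" if "i < 2" for i v c u
    unfolding D_def using holomorphic_fun_on_frechet_derivative(2)[OF hol[OF that]] by simp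
  have D_add: "D i v (u + w) = D i v u + D i v w" if "i < 2" for i v u w
    unfolding D_def using linear_add[OF holomorphic_fun_on_frechet_derivative(3)[OF hol[OF that]]] by simp
  have D_tangent: "D i v (tangent1 v) = 0" "D i v (tangent2 v) = 0" "D i v (tangent3 v) = 0"
    if "i < 2" "v \<in> sphere 0 1" for i v
    unfolding D_def using tangent_lines_in_threefold[OF that(2)] that(1) zeros
    by (auto intro!: frechet_derivative_eq_0_along_complex_line[OF hol[OF that(1)]])
  show False
  proof (rule no_nonvanishing_weight_2_on_sphere[of E])
    have "continuous_on (sphere 0 1) pt" "continuous_on (sphere 0 1) normal1" "continuous_on (sphere 0 1) normal2"
      unfolding pt_def normal1_def normal2_def case_prod_unfold
      by (intro continuous_on_vector_5 continuous_intros)+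
    then show "continuous_on (sphere 0 1) E"
      unfolding E_def D_def
      by (intro continuous_intros continuous_on_frechet_derivative hol) auto
  next
    fix v :: "complex \<times> complex" assume v: "v \<in> sphere 0 1"
    show "E v \<noteq> 0"
    proof
      assume "E v = 0"
      then have "D 0 v (normal1 v) * D 1 v (normal2 v) - D 1 v (normal1 v) * D 0 v (normal2 v) = 0"
        by (simp add: E_def)
      then obtain c0 c1 where c: "c0 \<noteq> 0 \<or> c1 \<noteq> 0"
        "c0 * D 0 v (normal1 v) + c1 * D 1 v (normal1 v) = 0"
        "c0 * D 0 v (normal2 v) + c1 * D 1 v (normal2 v) = 0"
        by (rule singular_2x2_left_kernel)
      have "c0 * D 0 v u + c1 * D 1 v u = 0" for u
      proof -
        obtain a1 a2 a3 b1 b2 where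
          "u = a1 *s tangent1 v + a2 *s tangent2 v + a3 *s tangent3 v + b1 *s normal1 v + b2 *s normal2 v"
          by (rule pt_frame_spans[OF v])
        then have "c0 * D 0 v u + c1 * D 1 v u =
          b1 * (c0 * D 0 v (normal1 v) + c1 * D 1 v (normal1 v)) +
          b2 * (c0 * D 0 v (normal2 v) + c1 * D 1 v (normal2 v))"
          by (simp add: D_add D_scale D_tangent[OF _ v] algebra_simps)
        then show ?thesis using c by simp
      qed
      moreover have "pt v \<in> threefold"
        using tangent_lines_in_threefold(1)[OF v, of 0] by simp
      ultimately have zero: "\<forall>i<2::nat. (if i = 0 then c0 else c1) = 0"
        using indep[of "pt v" "\<lambda>i. if i = 0 then c0 else c1"] by (simp add: two D_def)
      from zero[rule_format, of 0] zero[rule_format, of 1] show False using c(1) by simp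
    qed
  next
    fix x y :: complex and t :: real
    have 1: "cis t * cis (- t) = 1" by (simp add: cis_mult)
    have cancel: "cis t * (a * cis (- t)) = a" "cis t * (a * (cis (- t) * b)) = a * b" for a b
      using 1 by algebra+
    \<comment> \<open>\<open>pt\<close> and \<open>normal1\<close> depend only on the projection
      \<open>v v^*\<close>, hence are invariant; \<open>normal2\<close> is quadratic in the
      conjugates, which produces the weight -2.\<close>
    have "pt (cis t * x, cis t * y) = pt (x, y)" "normal1 (cis t * x, cis t * y) = normal1 (x, y)"
      by (simp_all add: pt_def normal1_def cis_cnj cancel algebra_simps)
    moreover have "normal2 (cis t * x, cis t * y) = cis (- 2 * t) *s normal2 (x, y)"
      by (simp add: normal2_def vec_eq_iff forall_5 cis_cnj power_mult_distrib Complex.DeMoivre)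
    ultimately show "E (cis t * x, cis t * y) = cis (- 2 * t) * E (x, y)"
      by (simp add: E_def D_def D_scale[unfolded D_def] algebra_simps)
  qed
qed

theorem mainTheorem1:
  shows "\<exists>Y :: (complex^5) set.
           closed_complex_submanifold 3 Y \<and>
           differentiable_complete_intersection (2 * (5 - 3)) Y \<and>
           \<not> holomorphic_complete_intersection (5 - 3) Y"
  using closed_complex_submanifold_threefold differentiable_complete_intersection_threefold
    not_holomorphic_complete_intersection_threefold
  by (intro exI[of _ threefold]) simp

end
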